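(* Let $g$ be an arithmetical function, and for positive integers $a,b$ define $$f(a,b)=\sum_{d\mid a}g(d)-\sum_{d\mid (a,b)}g(d).$$ Then for every positive integer $n$, $$[f(i,j)]_{n\times n}=C_n\,\mathrm{diag}[g(1),g(2),\ldots,g(n)]\,D_n^T,$$ where $C_n=[c_{ij}]_{n\times n}$ and $D_n=[d_{ij}]_{n\times n}$ are the $n\times n$ matrices given by $$c_{ij}=\begin{cases}1,& j\mid i\\ 0,& j\nmid i\end{cases},\qquad d_{ij}=\begin{cases}1,& j\nmid i\\ 0,& j\mid i.\end{cases}$$
   Context: An arithmetical function is a complex-valued function defined on the positive integers. $(a,b)$ denotes the greatest common divisor of $a$ and $b$, except that in $f(a,b)$ the pair $a,b$ is simply the list of arguments of the two-variable function $f$. Sums over $d\mid a$ run over the positive divisors $d$ of $a$. $[x_{ij}]_{n\times n}$ denotes the $n\times n$ matrix whose entry in row $i$, column $j$ is $x_{ij}$, for $1\le i,j\le n$; $\mathrm{diag}[x_1,\ldots,x_n]$ is the diagonal matrix with the listed diagonal entries, and $T$ denotes transpose. *)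

theory Defs
  imports Complex_Main "Jordan_Normal_Form.Matrix"
begin

text \<open>
  An arithmetical function is a function \<open>nat \<Rightarrow> complex\<close>; its value at \<open>0\<close> is junk and is
  never used below, since all divisors involved are divisors of positive integers.
\<close>

definition divisor_diff :: "(nat \<Rightarrow> complex) \<Rightarrow> nat \<Rightarrow> nat \<Rightarrow> complex" where
  "divisor_diff g a b = (\<Sum>d | d dvd a. g d) - (\<Sum>d | d dvd gcd a b. g d)"

text \<open>
  Matrix indices of the library start at \<open>0\<close>, whereas rows and columns here are numbered
  \<open>1, \<dots>, n\<close>: the 0-based position \<open>(i, j)\<close> carries the entry \<open>x (i + 1) (j + 1)\<close>.
\<close>

definition square_mat_of :: "nat \<Rightarrow> (nat \<Rightarrow> nat \<Rightarrow> complex) \<Rightarrow> complex mat" where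
  "square_mat_of n x = mat n n (\<lambda>(i, j). x (Suc i) (Suc j))"

definition C_mat :: "nat \<Rightarrow> complex mat" where
  "C_mat n = square_mat_of n (\<lambda>i j. if j dvd i then 1 else 0)"

definition D_mat :: "nat \<Rightarrow> complex mat" where
  "D_mat n = square_mat_of n (\<lambda>i j. if \<not> j dvd i then 1 else 0)"

end

theory Submission
  imports Defs
begin

text \<open>
  The divisors of \<open>gcd a b\<close> are exactly those divisors of \<open>a\<close> that also divide \<open>b\<close>, so the
  difference of the two divisor sums retains precisely the \<open>g d\<close> with \<open>d dvd a\<close> and
  \<open>\<not> d dvd b\<close> (lemma \<open>divisor_diff_eq_sum_nondivisors\<close>). Read as a sum over all
  \<open>d \<le> n\<close> with the two conditions turned into 0-1 factors, this is
  \<open>\<Sum>d. c\<^sub>i\<^sub>d * g d * d\<^sub>j\<^sub>d\<close>, the entry of the triple product: the range \<open>d \<le> n\<close> is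
  large enough because a divisor of \<open>i\<close> is at most \<open>i \<le> n\<close>
  (lemma \<open>divisor_diff_eq_indicator_sum\<close>).
\<close>

lemma divisor_diff_eq_sum_nondivisors:
  assumes "a > 0"
  shows "divisor_diff g a b = (\<Sum>d | d dvd a \<and> \<not> d dvd b. g d)"
proof -
  have "{d. d dvd a \<and> \<not> d dvd b} = {d. d dvd a} - {d. d dvd gcd a b}"
    by auto
  moreover have "{d. d dvd gcd a b} \<subseteq> {d. d dvd a}"
    by auto
  ultimately show ?thesis
    using assms by (simp add: divisor_diff_def sum_diff)
qed

text \<open>
  The summation index is shifted by one, as the matrix product sums over positions
  counted from \<open>0\<close>.
\<close>

lemma divisor_diff_eq_indicator_sum:
  assumes "a > 0" and "a \<le> n"
  shows "divisor_diff g a b =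
    (\<Sum>k<n. (if Suc k dvd a then 1 else 0) * g (Suc k) * (if \<not> Suc k dvd b then 1 else 0))"
proof -
  have "{d. d dvd a \<and> \<not> d dvd b} = {d \<in> {1..n}. d dvd a \<and> \<not> d dvd b}"
    using assms by (auto dest: dvd_imp_le intro: Suc_leI dvd_pos_nat)
  then have "divisor_diff g a b = (\<Sum>d \<in> {1..n}. if d dvd a \<and> \<not> d dvd b then g d else 0)"
    using assms(1) by (simp only: divisor_diff_eq_sum_nondivisors sum.inter_filter finite_atLeastAtMost)
  also have "\<dots> = (\<Sum>k<n. if Suc k dvd a \<and> \<not> Suc k dvd b then g (Suc k) else 0)"
    by (simp add: sum.atLeast1_atMost_eq)
  also have "\<dots> = (\<Sum>k<n. (if Suc k dvd a then 1 else 0) * g (Suc k)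
      * (if \<not> Suc k dvd b then 1 else 0))"
    by (intro sum.cong) auto
  finally show ?thesis .
qed

theorem theorem1:
  fixes g :: "nat \<Rightarrow> complex" and n :: nat
  assumes "n \<ge> 1"
  shows "square_mat_of n (divisor_diff g)
    = C_mat n * mat_diag n (\<lambda>k. g (Suc k)) * transpose_mat (D_mat n)"
proof -
  have C: "C_mat n \<in> carrier_mat n n"
    by (simp add: C_mat_def square_mat_of_def)
  show ?thesis
    unfolding mat_diag_mult_right[OF C]
    by (rule eq_matI)
      (auto simp: C_mat_def D_mat_def square_mat_of_def scalar_prod_def atLeast0LessThan
        divisor_diff_eq_indicator_sum[where n = n] intro!: sum.cong)
qed

end
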